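(* Let $\boldsymbol{\Upsilon}_{\mathbf{GP}}:\mathbf{GP}\to\mathbf{WQSym}$ be the linear map sending a generalized permutahedron $\mathfrak{q}\subseteq\mathbb{R}^n$ to $\boldsymbol{\Upsilon}_{\mathbf{GP}}(\mathfrak{q})=\sum_f\mathbf{a}_{f(1)}\cdots\mathbf{a}_{f(n)}$, the sum running over all $\mathfrak{q}$-generic functions $f:[n]\to\mathbb{N}$. Then the image of $\boldsymbol{\Upsilon}_{\mathbf{GP}}$ is precisely $\mathbf{SC}$.
   Context: $\mathbb{K}$ is a field of characteristic zero; $\mathbb{N}=\{1,2,\dots\}$, $[n]=\{1,\dots,n\}$; $\{\mathbf{a}_i\}_{i\ge1}$ are non-commuting variables. For non-empty $J\subseteq[n]$ let $\mathfrak{s}_J=\mathrm{conv}\{e_j : j\in J\}\subseteq\mathbb{R}^n$. A generalized permutahedron in $\mathbb{R}^n$ is a polytope $\mathfrak{q}$ of the form $\mathfrak{q}=\big(\sum_{a_J>0}a_J\mathfrak{s}_J\big)-\big(\sum_{a_J<0}|a_J|\mathfrak{s}_J\big)$ for real numbers $\{a_J\}_{\emptyset\ne J\subseteq[n]}$ for which the Minkowski difference exists; here $\mathfrak{a}-\mathfrak{b}$ denotes the unique polytope $\mathfrak{c}$ with $\mathfrak{b}+\mathfrak{c}=\mathfrak{a}$ (Minkowski sum), if it exists, and an empty Minkowski sum is $\{0\}$. $\mathbf{GP}=\bigoplus_{n\ge0}\mathbf{GP}_n$, with $\mathbf{GP}_n$ the $\mathbb{K}$-vector space freely generated by generalized permutahedra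 in $\mathbb{R}^n$. A function $f:[n]\to\mathbb{N}$ is $\mathfrak{q}$-generic if the face of $\mathfrak{q}$ on which $x\mapsto\sum_i f(i)x_i$ is minimized is a point. $\mathbf{C}_n$ is the set of set compositions $\vec{\boldsymbol{\pi}}=S_1|\cdots|S_k$ of $[n]$ (ordered lists of non-empty disjoint sets with union $[n]$). For non-empty $A\subseteq[n]$, $A_{\vec{\boldsymbol{\pi}}}=A\cap S_i$ with $i$ the smallest index such that $A\cap S_i\neq\emptyset$. For $f:[n]\to\mathbb{N}$, $\vec{\boldsymbol{\pi}}(f)$ is obtained from $f^{-1}(1)|f^{-1}(2)|\cdots$ by deleting empty sets. $\mathbf{M}_{\vec{\boldsymbol{\pi}}}=\sum_{f:\,\vec{\boldsymbol{\pi}}(f)=\vec{\boldsymbol{\pi}}}\mathbf{a}_{f(1)}\cdots\mathbf{a}_{f(n)}$; $\mathbf{WQSym}$ is the $\mathbb{K}$-span of all $\mathbf{M}_{\vec{\boldsymbol{\pi}}}$, $\vec{\boldsymbol{\pi}}\in\mathbf{C}_n$, $n\ge0$. On $\mathbf{C}_n$ set $\vec{\boldsymbol{\pi}}\sim\vec{\boldsymbol{\tau}}$ if for every non-empty $A\subseteq[n]$: $\#A_{\vec{\boldsymbol{\pi}}}=1\Leftrightarrow\#A_{\vec{\boldsymbol{\tau}}}=1$. Let $\mathbf{N}_{[\vec{\boldsymbol{\pi}}]}=\sum_{\vec{\boldsymbol{\tau}}\sim\vec{\boldsymbol{\pi}}}\mathbf{M}_{\vec{\boldsymbol{\tau}}}$.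 $\mathbf{SC}$ is the $\mathbb{K}$-span of all $\mathbf{N}_{[\vec{\boldsymbol{\pi}}]}$, $[\vec{\boldsymbol{\pi}}]\in\mathbf{C}_n/\!\sim$, $n\ge0$. *)

theory Defs
  imports
    "HOL-Analysis.Analysis"
    "HOL-Analysis.Finite_Function_Topology"
    "HOL-Library.Function_Algebras"
    "HOL-Library.Set_Algebras"
    "HOL-Library.Disjoint_Sets"
begin

section \<open>Generalized permutahedra\<close>

text \<open>
  The dimension varies, so all the spaces \<open>\<real>\<^sup>n\<close> are realised inside the real vector space of
  finitely supported functions \<open>nat \<Rightarrow>\<^sub>0 real\<close>, as the vectors supported in \<open>{1..n}\<close>.
  One set may therefore be a polytope in \<open>\<real>\<^sup>n\<close> for several \<open>n\<close>; the ambient dimension is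
  always kept as separate data.
\<close>

definition Rn :: "nat \<Rightarrow> (nat \<Rightarrow>\<^sub>0 real) set" where
  "Rn n = {x. Poly_Mapping.keys x \<subseteq> {1..n}}"

definition std_simplex :: "nat set \<Rightarrow> (nat \<Rightarrow>\<^sub>0 real) set" where
  "std_simplex J = convex hull ((\<lambda>j. Poly_Mapping.single j 1) ` J)"

text \<open>
  \<open>c\<close> is the Minkowski difference of \<open>a\<close> and \<open>b\<close>. For a non-empty polytope \<open>b\<close> there is at most
  one such \<open>c\<close>, by cancellation. Addition of sets, and its finite sums (with empty sum \<open>{0}\<close>),
  are those of \<open>Set_Algebras\<close>.
\<close>

definition is_minkowski_diff ::
    "'a::real_vector set \<Rightarrow> 'a set \<Rightarrow> 'a set \<Rightarrow> bool" where
  "is_minkowski_diff a b c \<longleftrightarrow> polytope c \<and> b + c = a"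

definition gen_permutahedron :: "nat \<Rightarrow> (nat \<Rightarrow>\<^sub>0 real) set \<Rightarrow> bool" where
  "gen_permutahedron n q \<longleftrightarrow> q \<subseteq> Rn n \<and>
     (\<exists>a :: nat set \<Rightarrow> real.
        is_minkowski_diff
          (\<Sum>J | J \<noteq> {} \<and> J \<subseteq> {1..n} \<and> a J > 0. (\<lambda>x. a J *\<^sub>R x) ` std_simplex J)
          (\<Sum>J | J \<noteq> {} \<and> J \<subseteq> {1..n} \<and> a J < 0. (\<lambda>x. \<bar>a J\<bar> *\<^sub>R x) ` std_simplex J)
          q)"

text \<open>Functions from \<open>[n]\<close> to the positive integers, extensional outside \<open>[n]\<close>.\<close>

definition pos_funs :: "nat \<Rightarrow> (nat \<Rightarrow> nat) set" where
  "pos_funs n = {1..n} \<rightarrow>\<^sub>E {1..}"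

definition lin_functional :: "nat \<Rightarrow> (nat \<Rightarrow> nat) \<Rightarrow> (nat \<Rightarrow>\<^sub>0 real) \<Rightarrow> real" where
  "lin_functional n f x = (\<Sum>i\<in>{1..n}. real (f i) * Poly_Mapping.lookup x i)"

definition generic :: "nat \<Rightarrow> (nat \<Rightarrow>\<^sub>0 real) set \<Rightarrow> (nat \<Rightarrow> nat) \<Rightarrow> bool" where
  "generic n q f \<longleftrightarrow>
     is_singleton {x \<in> q. \<forall>y\<in>q. lin_functional n f x \<le> lin_functional n f y}"

section \<open>Non-commutative power series\<close>

text \<open>
  A power series in the non-commuting variables \<open>a\<^sub>1, a\<^sub>2, \<dots>\<close> is given by its coefficients: the
  word \<open>[i\<^sub>1, \<dots>, i\<^sub>n]\<close> stands for the monomial \<open>a\<^sub>i\<^sub>1 \<cdots> a\<^sub>i\<^sub>n\<close>.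
\<close>

type_synonym 'k nc_series = "nat list \<Rightarrow> 'k"

definition nc_scale :: "'k::field \<Rightarrow> 'k nc_series \<Rightarrow> 'k nc_series" where
  "nc_scale c s = (\<lambda>w. c * s w)"

global_interpretation nc: vector_space "nc_scale :: 'k::field \<Rightarrow> 'k nc_series \<Rightarrow> 'k nc_series"
  by unfold_locales (auto simp: nc_scale_def fun_eq_iff algebra_simps)

text \<open>The formal sum of the monomials \<open>a\<^bsub>f(1)\<^esub> \<cdots> a\<^bsub>f(n)\<^esub>\<close> over \<open>f \<in> F\<close>, where \<open>F \<subseteq> pos_funs n\<close>.\<close>

definition monomial_sum :: "nat \<Rightarrow> (nat \<Rightarrow> nat) set \<Rightarrow> 'k::field nc_series" where
  "monomial_sum n F = (\<lambda>w. of_nat (card {f \<in> F. map f [1..<Suc n] = w}))"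

section \<open>Set compositions, WQSym and SC\<close>

definition set_compositions :: "nat \<Rightarrow> nat set list set" where
  "set_compositions n = {Ss. distinct Ss \<and> partition_on {1..n} (set Ss)}"

lemma finite_set_compositions: "finite (set_compositions n)"
proof (rule finite_subset)
  show "set_compositions n \<subseteq> {Ss. set Ss \<subseteq> Pow {1..n} \<and> distinct Ss}"
    by (auto simp: set_compositions_def partition_on_def)
  show "finite {Ss. set Ss \<subseteq> Pow {1..n} \<and> distinct Ss}"
    by (rule finite_subset_distinct) simp
qed

definition first_part :: "nat set \<Rightarrow> nat set list \<Rightarrow> nat set" where
  "first_part A Ss = A \<inter> Ss ! (LEAST i. i < length Ss \<and> A \<inter> Ss ! i \<noteq> {})"

text \<open>
  Deleting the empty sets from \<open>f\<^sup>-\<^sup>1(1) | f\<^sup>-\<^sup>1(2) | \<dots>\<close> leaves the fibres over the values attained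
  by \<open>f\<close>, in increasing order of these values.
\<close>

definition composition_of :: "nat \<Rightarrow> (nat \<Rightarrow> nat) \<Rightarrow> nat set list" where
  "composition_of n f = map (\<lambda>v. {i \<in> {1..n}. f i = v}) (sorted_list_of_set (f ` {1..n}))"

definition M_series :: "nat \<Rightarrow> nat set list \<Rightarrow> 'k::field nc_series" where
  "M_series n Ss = monomial_sum n {f \<in> pos_funs n. composition_of n f = Ss}"

definition WQSym :: "'k::field nc_series set" where
  "WQSym = nc.span {M_series n Ss | n Ss. Ss \<in> set_compositions n}"

definition sc_rel :: "nat \<Rightarrow> (nat set list \<times> nat set list) set" where
  "sc_rel n = {(Ss, Ts). Ss \<in> set_compositions n \<and> Ts \<in> set_compositions n \<and>
     (\<forall>A. A \<noteq> {} \<and> A \<subseteq> {1..n} \<longrightarrow>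
        (card (first_part A Ss) = 1 \<longleftrightarrow> card (first_part A Ts) = 1))}"

lemma equiv_sc_rel: "equiv (set_compositions n) (sc_rel n)"
  by (rule equivI) (auto simp: sc_rel_def refl_on_def sym_def trans_def)

definition N_series :: "nat \<Rightarrow> nat set list set \<Rightarrow> 'k::field nc_series" where
  "N_series n C = (\<Sum>Ts\<in>C. M_series n Ts)"

definition SC :: "'k::field nc_series set" where
  "SC = nc.span {N_series n C | n C. C \<in> set_compositions n // sc_rel n}"

section \<open>The linear map on generalized permutahedra\<close>

text \<open>
  The direct sum over \<open>n\<close> of the vector spaces freely generated by the generalized permutahedra
  in \<open>\<real>\<^sup>n\<close>: finitely supported coefficient functions on pairs \<open>(n, q)\<close>.
\<close>

definition GP :: "(nat \<times> (nat \<Rightarrow>\<^sub>0 real) set \<Rightarrow>\<^sub>0 'k::field) set" where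
  "GP = {x. Poly_Mapping.keys x \<subseteq> {(n, q). gen_permutahedron n q}}"

definition generic_series :: "nat \<times> (nat \<Rightarrow>\<^sub>0 real) set \<Rightarrow> 'k::field nc_series" where
  "generic_series = (\<lambda>(n, q). monomial_sum n {f \<in> pos_funs n. generic n q f})"

definition Upsilon_GP ::
    "(nat \<times> (nat \<Rightarrow>\<^sub>0 real) set \<Rightarrow>\<^sub>0 'k::field) \<Rightarrow> 'k nc_series" where
  "Upsilon_GP x =
     (\<Sum>b\<in>Poly_Mapping.keys x. nc_scale (Poly_Mapping.lookup x b) (generic_series b))"

lemma Upsilon_GP_superset:
  assumes "finite B" "Poly_Mapping.keys x \<subseteq> B"
  shows "Upsilon_GP x = (\<Sum>b\<in>B. nc_scale (Poly_Mapping.lookup x b) (generic_series b))"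
  unfolding Upsilon_GP_def
  by (rule sum.mono_neutral_left) (use assms in \<open>auto simp: in_keys_iff nc.scale_zero_left\<close>)

lemma Upsilon_GP_single: "Upsilon_GP (Poly_Mapping.single b 1) = generic_series b"
  by (subst Upsilon_GP_superset[of "{b}"]) (auto simp: nc.scale_one)

lemma Upsilon_GP_add: "Upsilon_GP (x + y) = Upsilon_GP x + Upsilon_GP y"
proof -
  let ?B = "Poly_Mapping.keys x \<union> Poly_Mapping.keys y"
  show ?thesis
    using Poly_Mapping.keys_add[of x y]
    by (simp add: Upsilon_GP_superset[of ?B] lookup_add nc.scale_left_distrib sum.distrib)
qed

lemma Upsilon_GP_scale:
  "Upsilon_GP (Poly_Mapping.map ((*) c) x) = nc_scale c (Upsilon_GP x)"
proof -
  have sub: "Poly_Mapping.keys (Poly_Mapping.map ((*) c) x) \<subseteq> Poly_Mapping.keys x"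
    by (auto simp: in_keys_iff Poly_Mapping.map.rep_eq when_def)
  show ?thesis
    by (subst Upsilon_GP_superset[OF finite_keys sub], subst Upsilon_GP_def,
        unfold nc.scale_sum_right, intro sum.cong refl)
      (auto simp: Poly_Mapping.map.rep_eq when_def in_keys_iff)
qed

end

theory Submission
  imports Defs
begin

text \<open>
  The face of \<open>q\<close> minimizing \<open>f\<close> is the Minkowski difference of the corresponding faces of the two
  sums of simplices, and the face of \<open>s\<^sub>J\<close> is the simplex on
  \<open>J\<^bsub>f\<^esub> = {j \<in> J. f j minimal}\<close>. The former face is a point iff it has
  width zero in every coordinate direction \<open>i\<close>, that is, iff the coefficients \<open>a\<^sub>J\<close> with \<open>i \<in> J\<^bsub>f\<^esub>\<close> and
  \<open>#J\<^bsub>f\<^esub> \<noteq> 1\<close> sum to zero. If the set compositions of \<open>f\<close> and \<open>g\<close> are equivalent, then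
  \<open>J\<^bsub>f\<^esub> = J\<^bsub>g\<^esub>\<close> whenever \<open>#J\<^bsub>f\<^esub> \<noteq> 1\<close>, so genericity depends only on the equivalence class and the image
  lies in \<open>SC\<close>.

  Conversely, for a set composition \<open>\<pi>\<close> let \<open>q\<close> be the sum of all \<open>s\<^sub>J\<close> with \<open>#J\<^bsub>\<pi>\<^esub> = 1\<close>. Its series is the sum
  of the \<open>N\<^bsub>[\<tau>]\<^esub>\<close> over the classes all of whose non-singleton \<open>J\<^bsub>\<tau>\<^esub>\<close> have \<open>#J\<^bsub>\<pi>\<^esub> \<noteq> 1\<close>. This system is
  unitriangular, so every \<open>N\<^bsub>[\<pi>]\<^esub>\<close> is a combination of such series.
\<close>

section \<open>Faces and widths of Minkowski sums\<close>

text \<open>One notion covers faces of polytopes, where \<open>r\<close> is a linear functional, and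
  first parts of set compositions, where \<open>r\<close> ranks the elements of [n].\<close>

definition minimizers :: "('a \<Rightarrow> 'b::linorder) \<Rightarrow> 'a set \<Rightarrow> 'a set" where
  "minimizers r A = {x \<in> A. \<forall>y\<in>A. r x \<le> r y}"

lemma minimizers_subset: "minimizers r A \<subseteq> A"
  by (auto simp: minimizers_def)

lemma minimizers_nonempty:
  assumes "finite A" "A \<noteq> {}"
  shows "minimizers r A \<noteq> {}"
proof -
  have "Min (r ` A) \<in> r ` A"
    using assms by simp
  then obtain x where "x \<in> A" "r x = Min (r ` A)"
    by (metis imageE)
  then have "x \<in> minimizers r A"
    using assms by (auto simp: minimizers_def)
  then show ?thesis by blast
qed

text \<open>If one summand could be improved while the other stays fixed, the sum would improve as
  well.\<close>

lemma minimizers_add: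
  fixes \<phi> :: "'a::real_vector \<Rightarrow> real"
  assumes "linear \<phi>"
  shows "minimizers \<phi> (A + B) = minimizers \<phi> A + minimizers \<phi> B"
proof -
  have add: "\<phi> (x + y) = \<phi> x + \<phi> y" for x y
    using assms by (rule linear_add)
  show ?thesis
  proof (intro equalityI subsetI)
    fix z assume z: "z \<in> minimizers \<phi> (A + B)"
    then obtain x y where xy: "z = x + y" "x \<in> A" "y \<in> B"
      by (auto simp: minimizers_def elim: set_plus_elim)
    have le: "\<phi> (x + y) \<le> \<phi> (x' + y')" if "x' \<in> A" "y' \<in> B" for x' y'
      using z that xy(1) by (auto simp: minimizers_def)
    have "x \<in> minimizers \<phi> A" "y \<in> minimizers \<phi> B"
      using xy le[of _ y] le[of x] by (auto simp: minimizers_def add)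
    then show "z \<in> minimizers \<phi> A + minimizers \<phi> B"
      using xy by blast
  next
    fix z assume "z \<in> minimizers \<phi> A + minimizers \<phi> B"
    then obtain x y where "z = x + y" "x \<in> minimizers \<phi> A" "y \<in> minimizers \<phi> B"
      by (auto elim: set_plus_elim)
    then show "z \<in> minimizers \<phi> (A + B)"
      by (auto simp: minimizers_def add intro!: add_mono elim!: set_plus_elim)
  qed
qed

lemma minimizers_sum:
  fixes \<phi> :: "'a::real_vector \<Rightarrow> real"
  assumes "linear \<phi>"
  shows "minimizers \<phi> (\<Sum>i\<in>I. A i) = (\<Sum>i\<in>I. minimizers \<phi> (A i))"
proof (induction I rule: infinite_finite_induct)
  case (insert i I)
  then show ?case by (simp add: minimizers_add assms)
qed (auto simp: minimizers_def)

lemma minimizers_scaleR: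
  fixes \<phi> :: "'a::real_vector \<Rightarrow> real"
  assumes "linear \<phi>" "c > 0"
  shows "minimizers \<phi> ((\<lambda>x. c *\<^sub>R x) ` A) = (\<lambda>x. c *\<^sub>R x) ` minimizers \<phi> A"
proof -
  have "\<phi> (c *\<^sub>R x) = c * \<phi> x" for x
    using linear_scale[OF assms(1)] by simp
  then show ?thesis
    using assms(2) by (auto simp: minimizers_def)
qed

text \<open>
  For linear \<open>\<psi>\<close> this is additive and cancellable with respect to Minkowski sums, so the widths of
  a Minkowski difference can be computed without describing the difference itself.
\<close>

definition has_width :: "('a \<Rightarrow> real) \<Rightarrow> 'a set \<Rightarrow> real \<Rightarrow> bool" where
  "has_width \<psi> X w \<longleftrightarrow>
     (\<exists>x\<in>X. \<exists>y\<in>X. \<psi> x - \<psi> y = w) \<and> (\<forall>x\<in>X. \<forall>y\<in>X. \<psi> x - \<psi> y \<le> w)"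

lemma has_width_zero_iff:
  "has_width \<psi> X 0 \<longleftrightarrow> X \<noteq> {} \<and> (\<forall>x\<in>X. \<forall>y\<in>X. \<psi> x = \<psi> y)"
proof
  assume w: "has_width \<psi> X 0"
  have "\<psi> x = \<psi> y" if "x \<in> X" "y \<in> X" for x y
  proof (rule order_antisym)
    show "\<psi> x \<le> \<psi> y" "\<psi> y \<le> \<psi> x"
      using w that by (simp_all add: has_width_def)
  qed
  then show "X \<noteq> {} \<and> (\<forall>x\<in>X. \<forall>y\<in>X. \<psi> x = \<psi> y)"
    using w unfolding has_width_def by blast
next
  assume *: "X \<noteq> {} \<and> (\<forall>x\<in>X. \<forall>y\<in>X. \<psi> x = \<psi> y)"
  then obtain x where "x \<in> X"
    by blast
  moreover have "\<psi> x - \<psi> y = 0" if "x \<in> X" "y \<in> X" for x y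
    unfolding right_minus_eq using * that by blast
  ultimately show "has_width \<psi> X 0"
    unfolding has_width_def by (metis order_refl)
qed

lemma has_width_unique: "has_width \<psi> X v \<Longrightarrow> has_width \<psi> X w \<Longrightarrow> v = w"
  unfolding has_width_def by (metis order_antisym)

lemma has_width_add:
  fixes \<psi> :: "'a::real_vector \<Rightarrow> real"
  assumes "linear \<psi>" "has_width \<psi> A v" "has_width \<psi> B w"
  shows "has_width \<psi> (A + B) (v + w)"
proof -
  have add: "\<psi> (x + y) = \<psi> x + \<psi> y" for x y
    using assms(1) by (rule linear_add)
  obtain a a' b b' where "a \<in> A" "a' \<in> A" "\<psi> a - \<psi> a' = v" "b \<in> B" "b' \<in> B" "\<psi> b - \<psi> b' = w"
    using assms(2,3) by (auto simp: has_width_def)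
  then have "a + b \<in> A + B" "a' + b' \<in> A + B" "\<psi> (a + b) - \<psi> (a' + b') = v + w"
    by (auto simp: add)
  moreover have "\<psi> x - \<psi> y \<le> v + w" if xy: "x \<in> A + B" "y \<in> A + B" for x y
  proof -
    obtain a b a' b' where "x = a + b" "y = a' + b'" "a \<in> A" "b \<in> B" "a' \<in> A" "b' \<in> B"
      using xy by (auto elim!: set_plus_elim)
    moreover from this have "\<psi> a - \<psi> a' \<le> v" "\<psi> b - \<psi> b' \<le> w"
      using assms(2,3) by (auto simp: has_width_def)
    ultimately show ?thesis by (simp add: add)
  qed
  ultimately show ?thesis unfolding has_width_def by blast
qed

lemma has_width_sum:
  fixes \<psi> :: "'a::real_vector \<Rightarrow> real"
  assumes "linear \<psi>" "\<And>i. i \<in> I \<Longrightarrow> has_width \<psi> (A i) (w i)"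
  shows "has_width \<psi> (\<Sum>i\<in>I. A i) (\<Sum>i\<in>I. w i)"
  using assms(2)
proof (induction I rule: infinite_finite_induct)
  case (insert i I)
  then show ?case by (simp add: has_width_add assms(1))
\<comment> \<open>For empty or infinite \<open>I\<close> both sums are zero, and \<open>{0}\<close>
  has width 0.\<close>
qed (auto simp: has_width_def)

text \<open>Adding a pair from \<open>C\<close> to a widest pair of \<open>B\<close> bounds the
  spread in \<open>C\<close> by \<open>w - v\<close>. The \<open>C\<close>-components of a widest
  pair of \<open>B + C\<close> attain this bound, because its \<open>B\<close>-components contribute
  at most \<open>v\<close>.\<close>

lemma has_width_cancel:
  fixes \<psi> :: "'a::real_vector \<Rightarrow> real"
  assumes "linear \<psi>" "has_width \<psi> B v" "has_width \<psi> (B + C) w"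
  shows "has_width \<psi> C (w - v)"
proof -
  have add: "\<psi> (x + y) = \<psi> x + \<psi> y" for x y
    using assms(1) by (rule linear_add)
  obtain b b' where b: "b \<in> B" "b' \<in> B" "\<psi> b - \<psi> b' = v"
    using assms(2) by (auto simp: has_width_def)
  have upper: "\<psi> x - \<psi> y \<le> w - v" if "x \<in> C" "y \<in> C" for x y
  proof -
    have "\<psi> (b + x) - \<psi> (b' + y) \<le> w"
      using assms(3) b that by (auto simp: has_width_def)
    then show ?thesis using b by (simp add: add)
  qed
  obtain z z' where "z \<in> B + C" "z' \<in> B + C" and z: "\<psi> z - \<psi> z' = w"
    using assms(3) by (auto simp: has_width_def)
  then obtain d d' x y where
    xy: "z = d + x" "z' = d' + y" "d \<in> B" "d' \<in> B" "x \<in> C" "y \<in> C"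
    by (auto elim!: set_plus_elim)
  have "\<psi> d - \<psi> d' \<le> v"
    using assms(2) xy by (auto simp: has_width_def)
  then have "w - v \<le> \<psi> x - \<psi> y"
    using z xy by (simp add: add)
  then have "\<psi> x - \<psi> y = w - v"
    using upper xy by (simp add: order_antisym)
  then show ?thesis
    using upper xy unfolding has_width_def by blast
qed

lemma has_width_scaleR:
  assumes "linear \<psi>" "c \<ge> 0" "has_width \<psi> A w"
  shows "has_width \<psi> ((\<lambda>x. c *\<^sub>R x) ` A) (c * w)"
proof -
  have "\<psi> (c *\<^sub>R x) - \<psi> (c *\<^sub>R y) = c * (\<psi> x - \<psi> y)" for x y
    using linear_scale[OF assms(1)] by (simp add: right_diff_distrib)
  then show ?thesis
    using assms(2,3) by (auto simp: has_width_def mult_left_mono)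
qed

section \<open>Simplices\<close>

lemma lookup_scaleR: "Poly_Mapping.lookup (c *\<^sub>R x) i = c *\<^sub>R Poly_Mapping.lookup x i"
proof -
  have "finite {i. c *\<^sub>R Poly_Mapping.lookup x i \<noteq> 0}"
    by (rule finite_subset[OF _ finite_keys[of x]]) (auto simp: in_keys_iff)
  then show ?thesis
    by (simp add: scaleR_poly_mapping_def)
qed

lemma linear_lookup: "linear (\<lambda>x. Poly_Mapping.lookup x i :: real)"
  by (rule linearI) (simp_all add: lookup_add lookup_scaleR)

lemma linear_lin_functional: "linear (lin_functional n f)"
proof (rule linearI)
  fix x y :: "nat \<Rightarrow>\<^sub>0 real" and c :: real
  show "lin_functional n f (x + y) = lin_functional n f x + lin_functional n f y"
    by (simp add: lin_functional_def lookup_add distrib_left sum.distrib)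
  show "lin_functional n f (c *\<^sub>R x) = c *\<^sub>R lin_functional n f x"
    by (simp add: lin_functional_def lookup_scaleR sum_distrib_left ac_simps)
qed

text \<open>These are barycentric coordinates: the weights of a point with respect to the vertices
  are its own coordinates.\<close>

lemma std_simplex_eq:
  assumes "finite J"
  shows "std_simplex J = {x. Poly_Mapping.keys x \<subseteq> J \<and>
    (\<forall>j. 0 \<le> Poly_Mapping.lookup x j) \<and> (\<Sum>j\<in>J. Poly_Mapping.lookup x j) = 1}" (is "_ = ?S")
proof (rule equalityI)
  have "convex ?S"
  proof (rule convexI)
    fix x y :: "nat \<Rightarrow>\<^sub>0 real" and u v :: real
    assume xy: "x \<in> ?S" "y \<in> ?S" and uv: "0 \<le> u" "0 \<le> v" "u + v = 1"
    have "Poly_Mapping.keys (u *\<^sub>R x + v *\<^sub>R y) \<subseteq>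
        Poly_Mapping.keys x \<union> Poly_Mapping.keys y"
      by (auto simp: in_keys_iff lookup_add lookup_scaleR)
    moreover have "(\<Sum>j\<in>J. Poly_Mapping.lookup (u *\<^sub>R x + v *\<^sub>R y) j) =
        u * (\<Sum>j\<in>J. Poly_Mapping.lookup x j) + v * (\<Sum>j\<in>J. Poly_Mapping.lookup y j)"
      by (simp add: lookup_add lookup_scaleR sum.distrib sum_distrib_left)
    moreover have "0 \<le> Poly_Mapping.lookup (u *\<^sub>R x + v *\<^sub>R y) j" for j
      using xy uv by (simp add: lookup_add lookup_scaleR)
    ultimately show "u *\<^sub>R x + v *\<^sub>R y \<in> ?S"
      using xy uv by auto
  qed
  then show "std_simplex J \<subseteq> ?S"
    unfolding std_simplex_def
    by (intro hull_minimal) (auto simp: lookup_single when_def assms)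
next
  show "?S \<subseteq> std_simplex J"
  proof
    fix x assume x: "x \<in> ?S"
    have "x = (\<Sum>j\<in>J. Poly_Mapping.lookup x j *\<^sub>R Poly_Mapping.single j 1)"
    proof (rule poly_mapping_eqI)
      fix i
      have "(\<Sum>j\<in>J. Poly_Mapping.lookup x j *\<^sub>R (1 when j = i)) =
          (\<Sum>j\<in>J. if j = i then Poly_Mapping.lookup x j else 0)"
        by (rule sum.cong) (auto simp: when_def)
      also have "\<dots> = Poly_Mapping.lookup x i"
        using x assms by (auto simp: in_keys_iff)
      finally show "Poly_Mapping.lookup x i = Poly_Mapping.lookup
          (\<Sum>j\<in>J. Poly_Mapping.lookup x j *\<^sub>R Poly_Mapping.single j 1) i"
        by (simp add: lookup_sum lookup_scaleR lookup_single)
    qed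
    also have "\<dots> \<in> std_simplex J"
      unfolding std_simplex_def
      by (rule convex_sum) (use x assms in \<open>auto intro: hull_inc convex_convex_hull\<close>)
    finally show "x \<in> std_simplex J" .
  qed
qed

lemma single_in_std_simplex: "j \<in> J \<Longrightarrow> Poly_Mapping.single j 1 \<in> std_simplex J"
  unfolding std_simplex_def by (rule hull_inc) simp

text \<open>On the simplex the functional is the average of the values \<open>f j\<close> weighted
  by the coordinates, so it is minimal exactly when no weight falls on a vertex with non-minimal
  value.\<close>

lemma minimizers_std_simplex:
  assumes J: "J \<noteq> {}" "J \<subseteq> {1..n}"
  shows "minimizers (lin_functional n f) (std_simplex J) = std_simplex (minimizers f J)"
    (is "?L = ?R")
proof -
  let ?l = "Poly_Mapping.lookup"
  have fin: "finite J" "finite (minimizers f J)"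
    using J by (auto intro: finite_subset[OF minimizers_subset] finite_subset)
  obtain k where k: "k \<in> minimizers f J"
    using minimizers_nonempty[OF fin(1) J(1), of f] by blast
  then have kJ: "k \<in> J" and f_ge: "\<And>j. j \<in> J \<Longrightarrow> f k \<le> f j"
    by (auto simp: minimizers_def)
  have mem_min: "j \<in> minimizers f J \<longleftrightarrow> j \<in> J \<and> f j = f k" for j
    using k by (auto simp: minimizers_def intro: order_antisym)
  \<comment> \<open>The coordinates sum to 1, so subtracting \<open>f k\<close> leaves a sum of
    non-negative terms, which vanishes only termwise.\<close>
  have diff: "lin_functional n f x - f k = (\<Sum>j\<in>J. (real (f j) - real (f k)) * ?l x j)"
    if "x \<in> std_simplex J" for x
  proof -
    have "(\<Sum>i\<in>{1..n}. real (f i) * ?l x i) = (\<Sum>i\<in>J. real (f i) * ?l x i)"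
      by (rule sum.mono_neutral_right)
        (use J that in \<open>auto simp: std_simplex_eq[OF fin(1)] in_keys_iff\<close>)
    then show ?thesis
      using that fin
      by (simp add: lin_functional_def std_simplex_eq left_diff_distrib sum_subtractf
          flip: sum_distrib_left)
  qed
  have nonneg: "0 \<le> (real (f j) - real (f k)) * ?l x j" if "x \<in> std_simplex J" "j \<in> J" for x j
    using that f_ge[of j] fin by (simp add: std_simplex_eq)
  have ge: "f k \<le> lin_functional n f x" if "x \<in> std_simplex J" for x
  proof -
    have "0 \<le> (\<Sum>j\<in>J. (real (f j) - real (f k)) * ?l x j)"
      by (rule sum_nonneg) (rule nonneg[OF that])
    then show ?thesis using diff[OF that] by linarith
  qed
  have "lin_functional n f (Poly_Mapping.single k 1) = f k"
    using kJ J by (auto simp: lin_functional_def lookup_single when_def if_distrib cong: if_cong)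
  then have "x \<in> ?L \<longleftrightarrow> x \<in> std_simplex J \<and> lin_functional n f x = f k" for x
    using ge single_in_std_simplex[OF kJ] unfolding minimizers_def
    by (auto intro!: order_antisym) (metis)
  moreover have "lin_functional n f x = f k \<longleftrightarrow> (\<forall>j\<in>J. f j \<noteq> f k \<longrightarrow> ?l x j = 0)"
    if "x \<in> std_simplex J" for x
  proof -
    have "lin_functional n f x = f k \<longleftrightarrow> (\<Sum>j\<in>J. (real (f j) - real (f k)) * ?l x j) = 0"
      using diff[OF that] by linarith
    also have "\<dots> \<longleftrightarrow> (\<forall>j\<in>J. (real (f j) - real (f k)) * ?l x j = 0)"
      by (rule sum_nonneg_eq_0_iff[OF fin(1) nonneg[OF that]])
    finally show ?thesis by auto
  qed
  moreover have "x \<in> ?R \<longleftrightarrow> x \<in> std_simplex J \<and> (\<forall>j\<in>J. f j \<noteq> f k \<longrightarrow> ?l x j = 0)" for x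
  proof -
    have keys: "Poly_Mapping.keys x \<subseteq> minimizers f J \<longleftrightarrow>
        Poly_Mapping.keys x \<subseteq> J \<and> (\<forall>j\<in>J. f j \<noteq> f k \<longrightarrow> ?l x j = 0)"
      unfolding subset_iff in_keys_iff mem_min by blast
    have "(\<Sum>j\<in>minimizers f J. ?l x j) = (\<Sum>j\<in>J. ?l x j)"
      if "Poly_Mapping.keys x \<subseteq> minimizers f J"
      by (rule sum.mono_neutral_left) (use that fin minimizers_subset[of f J] in \<open>auto simp: in_keys_iff subset_iff\<close>)
    then show ?thesis
      using keys fin by (auto simp: std_simplex_eq)
  qed
  ultimately show ?thesis by blast
qed

text \<open>Coordinate \<open>i\<close> is 0 throughout when \<open>i\<close> lies outside
  \<open>K\<close>, and 1 throughout when \<open>K = {i}\<close>. Otherwise it is 1 at vertex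
  \<open>i\<close>, 0 at another vertex, and between 0 and 1 everywhere.\<close>

lemma has_width_std_simplex:
  assumes "finite K" "K \<noteq> {}"
  shows "has_width (\<lambda>x. Poly_Mapping.lookup x i) (std_simplex K)
    (if i \<in> K \<and> card K \<noteq> 1 then 1 else 0)"
proof -
  let ?l = "Poly_Mapping.lookup"
  have nn: "0 \<le> ?l x i" if "x \<in> std_simplex K" for x
    using that assms by (simp add: std_simplex_eq)
  consider "i \<notin> K" | "K = {i}" | k where "i \<in> K" "k \<in> K" "k \<noteq> i"
    using assms(2) by blast
  then show ?thesis
  proof cases
    case 1
    then have "?l x i = 0" if "x \<in> std_simplex K" for x
      using that assms by (auto simp: std_simplex_eq in_keys_iff)
    then show ?thesis
      using 1 assms(2) single_in_std_simplex by (fastforce simp: has_width_zero_iff)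
  next
    case 2
    then show ?thesis by (simp add: has_width_zero_iff std_simplex_def)
  next
    case 3
    then have "card K \<noteq> 1"
      by (auto simp: card_1_singleton_iff)
    have le: "?l x i \<le> 1" if "x \<in> std_simplex K" for x
      using member_le_sum[OF 3(1), of "?l x"] that assms by (simp add: std_simplex_eq)
    have "?l x i - ?l y i \<le> 1" if "x \<in> std_simplex K" "y \<in> std_simplex K" for x y
      using le[OF that(1)] nn[OF that(2)] by linarith
    moreover have "?l (Poly_Mapping.single i 1) i - ?l (Poly_Mapping.single k 1) i = (1::real)"
      using 3 by (simp add: lookup_single when_def)
    ultimately have "has_width (\<lambda>x. ?l x i) (std_simplex K) 1"
      unfolding has_width_def using 3(1,2) single_in_std_simplex by blast
    then show ?thesis
      using 3(1) \<open>card K \<noteq> 1\<close> by simp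
  qed
qed

section \<open>Genericity\<close>

text \<open>
  With \<open>F J\<close> the face of \<open>J\<close> selected by \<open>f\<close>, this is the width in direction \<open>i\<close> of the face of the
  generalized permutahedron with coefficients \<open>a\<close> on which \<open>f\<close> is minimal.
\<close>

definition defect :: "nat \<Rightarrow> (nat set \<Rightarrow> real) \<Rightarrow> (nat set \<Rightarrow> nat set) \<Rightarrow> nat \<Rightarrow> real" where
  "defect n a F i =
     (\<Sum>J | J \<noteq> {} \<and> J \<subseteq> {1..n}. if i \<in> F J \<and> card (F J) \<noteq> 1 then a J else 0)"

lemma generic_iff_defect:
  assumes "q \<subseteq> Rn n" and
    diff: "is_minkowski_diff
       (\<Sum>J | J \<noteq> {} \<and> J \<subseteq> {1..n} \<and> a J > 0. (\<lambda>x. a J *\<^sub>R x) ` std_simplex J)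
       (\<Sum>J | J \<noteq> {} \<and> J \<subseteq> {1..n} \<and> a J < 0. (\<lambda>x. \<bar>a J\<bar> *\<^sub>R x) ` std_simplex J)
       q"
  shows "generic n q f \<longleftrightarrow> (\<forall>i\<in>{1..n}. defect n a (minimizers f) i = 0)"
proof -
  let ?\<phi> = "lin_functional n f" and ?c = "\<lambda>i x. Poly_Mapping.lookup x i"
  let ?w = "\<lambda>i J. if i \<in> minimizers f J \<and> card (minimizers f J) \<noteq> 1 then 1 else (0::real)"
  let ?I = "\<lambda>P. {J. J \<noteq> {} \<and> J \<subseteq> {1..n} \<and> P (a J)}"
  \<comment> \<open>Absolute values let one expression describe both sums; \<open>P\<close> is the
    sign condition.\<close>
  let ?S = "\<lambda>P. \<Sum>J\<in>?I P. (\<lambda>x. \<bar>a J\<bar> *\<^sub>R x) ` std_simplex J"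
  define Q where "Q = minimizers ?\<phi> q"
  have finI: "finite (?I P)" for P
    by (rule finite_subset[of _ "Pow {1..n}"]) auto
  have face: "minimizers ?\<phi> (?S P) = (\<Sum>J\<in>?I P. (\<lambda>x. \<bar>a J\<bar> *\<^sub>R x) ` std_simplex (minimizers f J))"
    if P: "\<not> P 0" for P
    unfolding minimizers_sum[OF linear_lin_functional]
  proof (rule sum.cong)
    fix J assume J: "J \<in> ?I P"
    then have "\<bar>a J\<bar> > 0"
      using P by auto
    then show "minimizers ?\<phi> ((\<lambda>x. \<bar>a J\<bar> *\<^sub>R x) ` std_simplex J) =
        (\<lambda>x. \<bar>a J\<bar> *\<^sub>R x) ` std_simplex (minimizers f J)"
      using J by (simp add: minimizers_scaleR[OF linear_lin_functional] minimizers_std_simplex)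
  qed simp
  have width: "has_width (?c i) (minimizers ?\<phi> (?S P)) (\<Sum>J\<in>?I P. \<bar>a J\<bar> * ?w i J)"
    if P: "\<not> P 0" for P i
    unfolding face[of P, OF P]
  proof (intro has_width_sum linear_lookup)
    fix J assume "J \<in> ?I P"
    then have J: "finite J" "J \<noteq> {}"
      by (auto intro: finite_subset)
    show "has_width (?c i) ((\<lambda>x. \<bar>a J\<bar> *\<^sub>R x) ` std_simplex (minimizers f J)) (\<bar>a J\<bar> * ?w i J)"
      by (intro has_width_scaleR linear_lookup abs_ge_zero has_width_std_simplex
          finite_subset[OF minimizers_subset] minimizers_nonempty J)
  qed
  have "?S (\<lambda>t. t > 0) =
      (\<Sum>J | J \<noteq> {} \<and> J \<subseteq> {1..n} \<and> a J > 0. (\<lambda>x. a J *\<^sub>R x) ` std_simplex J)"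
    by (rule sum.cong) simp_all
  then have "?S (\<lambda>t. t < 0) + q = ?S (\<lambda>t. t > 0)"
    using diff unfolding is_minkowski_diff_def by metis
  then have "minimizers ?\<phi> (?S (\<lambda>t. t < 0)) + Q = minimizers ?\<phi> (?S (\<lambda>t. t > 0))"
    by (simp only: Q_def flip: minimizers_add[OF linear_lin_functional])
  then have Q: "has_width (?c i) Q
      ((\<Sum>J\<in>?I (\<lambda>t. t > 0). \<bar>a J\<bar> * ?w i J) - (\<Sum>J\<in>?I (\<lambda>t. t < 0). \<bar>a J\<bar> * ?w i J))" for i
    using has_width_cancel[OF linear_lookup width[of "\<lambda>t. t < 0" i]] width[of "\<lambda>t. t > 0" i]
    by simp
  \<comment> \<open>Coefficients equal to 0 contribute to neither sum, so the difference is the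
    signed sum over all \<open>J\<close>.\<close>
  have "(\<Sum>J\<in>?I (\<lambda>t. t > 0). \<bar>a J\<bar> * ?w i J) - (\<Sum>J\<in>?I (\<lambda>t. t < 0). \<bar>a J\<bar> * ?w i J)
      = defect n a (minimizers f) i" for i
  proof -
    have fin: "finite {J. J \<noteq> {} \<and> J \<subseteq> {1..n}}"
      using finI[of "\<lambda>_. True"] by simp
    have filter: "(\<Sum>J | J \<noteq> {} \<and> J \<subseteq> {1..n} \<and> P J. g J) =
        (\<Sum>J | J \<noteq> {} \<and> J \<subseteq> {1..n}. if P J then g J else 0)"
      for P and g :: "nat set \<Rightarrow> real"
      using sum.inter_filter[OF fin, of g P] by (simp add: conj_assoc)
    show ?thesis
      unfolding defect_def filter sum_subtractf[symmetric]
      by (rule sum.cong) auto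
  qed
  with Q have Q: "has_width (?c i) Q (defect n a (minimizers f) i)" for i
    by simp
  \<comment> \<open>A width is attained by definition, so the face is non-empty without a
    compactness argument.\<close>
  then have Qne: "Q \<noteq> {}"
    unfolding has_width_def by blast
  \<comment> \<open>Outside [n] all coordinates vanish on the face, so the coordinates in [n]
    separate its points.\<close>
  have QRn: "?c i x = 0" if "x \<in> Q" "i \<notin> {1..n}" for x i
  proof -
    have "Poly_Mapping.keys x \<subseteq> {1..n}"
      using that(1) assms(1) minimizers_subset[of ?\<phi> q] unfolding Q_def Rn_def by blast
    then have "i \<notin> Poly_Mapping.keys x"
      using that(2) by blast
    then show ?thesis by (simp add: in_keys_iff)
  qed
  have eq_iff: "x = y \<longleftrightarrow> (\<forall>i\<in>{1..n}. ?c i x = ?c i y)" if "x \<in> Q" "y \<in> Q" for x y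
    using QRn that by (metis poly_mapping_eqI)
  have "generic n q f \<longleftrightarrow> is_singleton Q"
    by (simp add: generic_def Q_def minimizers_def)
  also have "\<dots> \<longleftrightarrow> (\<forall>x\<in>Q. \<forall>y\<in>Q. x = y)"
    using Qne unfolding is_singleton_def by blast
  also have "\<dots> \<longleftrightarrow> (\<forall>x\<in>Q. \<forall>y\<in>Q. \<forall>i\<in>{1..n}. ?c i x = ?c i y)"
    by (intro ball_cong refl eq_iff)
  also have "\<dots> \<longleftrightarrow> (\<forall>i\<in>{1..n}. \<forall>x\<in>Q. \<forall>y\<in>Q. ?c i x = ?c i y)"
    by blast
  also have "\<dots> \<longleftrightarrow> (\<forall>i\<in>{1..n}. has_width (?c i) Q 0)"
    unfolding has_width_zero_iff using Qne by blast
  also have "\<dots> \<longleftrightarrow> (\<forall>i\<in>{1..n}. defect n a (minimizers f) i = 0)"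
  proof (intro ball_cong refl iffI)
    fix i
    show "defect n a (minimizers f) i = 0" if "has_width (?c i) Q 0"
      using Q that by (rule has_width_unique)
    show "has_width (?c i) Q 0" if "defect n a (minimizers f) i = 0"
      using Q[of i] unfolding that .
  qed
  finally show ?thesis .
qed

section \<open>Set compositions as rankings\<close>

text \<open>The block of least index meeting \<open>A\<close> holds its elements of least rank. Any
  compatible ranking is allowed, so that both a function \<open>f\<close> and the block index of a
  given composition can serve.\<close>

lemma first_part_eq_minimizers:
  assumes "A \<subseteq> \<Union> (set Ss)" "A \<noteq> {}"
    and ord: "\<And>i j x y. i < length Ss \<Longrightarrow> j < length Ss \<Longrightarrow> x \<in> Ss ! i \<Longrightarrow> y \<in> Ss ! j \<Longrightarrow>
      r x \<le> r y \<longleftrightarrow> i \<le> j"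
  shows "first_part A Ss = minimizers r A"
proof -
  have idx: "\<exists>i<length Ss. x \<in> Ss ! i" if "x \<in> A" for x
    using assms(1) that by (metis UnionE in_set_conv_nth subsetD)
  define k where "k = (LEAST i. i < length Ss \<and> A \<inter> Ss ! i \<noteq> {})"
  have "\<exists>i. i < length Ss \<and> A \<inter> Ss ! i \<noteq> {}"
    using assms(2) idx by blast
  then have k: "k < length Ss" "A \<inter> Ss ! k \<noteq> {}"
    unfolding k_def by (metis (mono_tags, lifting) LeastI_ex)+
  have k_le: "k \<le> i" if "i < length Ss" "x \<in> A" "x \<in> Ss ! i" for i x
    unfolding k_def by (rule Least_le) (use that in blast)
  have "A \<inter> Ss ! k = minimizers r A"
  proof (intro equalityI subsetI)
    fix x assume x: "x \<in> A \<inter> Ss ! k"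
    have "r x \<le> r y" if "y \<in> A" for y
      using idx[OF that] k(1) k_le[OF _ that] ord x by blast
    then show "x \<in> minimizers r A"
      using x by (simp add: minimizers_def)
  next
    fix x assume x: "x \<in> minimizers r A"
    then obtain i where i: "i < length Ss" "x \<in> Ss ! i" "x \<in> A"
      using idx by (auto simp: minimizers_def)
    obtain z where z: "z \<in> A" "z \<in> Ss ! k"
      using k by blast
    then have "r x \<le> r z"
      using x by (simp add: minimizers_def)
    then have "i \<le> k"
      using ord i z k by blast
    then show "x \<in> A \<inter> Ss ! k"
      using k_le[of i x] i by simp
  qed
  then show ?thesis
    by (simp add: first_part_def k_def)
qed

lemma first_part_composition_of:
  assumes "A \<subseteq> {1..n}" "A \<noteq> {}"
  shows "first_part A (composition_of n f) = minimizers f A"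
proof (rule first_part_eq_minimizers)
  have "\<Union> (set (composition_of n f)) = {1..n}"
    unfolding composition_of_def by auto
  then show "A \<subseteq> \<Union> (set (composition_of n f))"
    using assms(1) by simp
next
  fix i j x y
  define vs where "vs = sorted_list_of_set (f ` {1..n})"
  assume "i < length (composition_of n f)" "j < length (composition_of n f)"
    "x \<in> composition_of n f ! i" "y \<in> composition_of n f ! j"
  then have "i < length vs" "j < length vs" "f x = vs ! i" "f y = vs ! j"
    by (auto simp: composition_of_def vs_def)
  \<comment> \<open>Blocks are the fibres over a strictly increasing list of values, so values
    compare like positions.\<close>
  moreover have "sorted_wrt (<) vs"
    by (simp add: vs_def)
  ultimately show "f x \<le> f y \<longleftrightarrow> i \<le> j"
    by (metis linorder_not_less nle_le sorted_wrt_nth_less)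
qed (use assms in simp)

lemma composition_of_in_set_compositions: "composition_of n f \<in> set_compositions n"
proof -
  have "inj_on (\<lambda>v. {i \<in> {1..n}. f i = v}) (f ` {1..n})"
    by (rule inj_onI) blast
  moreover have "partition_on {1..n} ((\<lambda>v. {i \<in> {1..n}. f i = v}) ` f ` {1..n})"
    by (auto simp: partition_on_def disjoint_def)
  ultimately show ?thesis
    by (simp add: set_compositions_def composition_of_def distinct_map)
qed

text \<open>The rank of an element is the index of its block, unique because the blocks are distinct
  and disjoint.\<close>

lemma set_composition_ranking:
  assumes "Ss \<in> set_compositions n"
  obtains r :: "nat \<Rightarrow> nat" where
    "\<And>A. A \<subseteq> {1..n} \<Longrightarrow> A \<noteq> {} \<Longrightarrow> first_part A Ss = minimizers r A"
proof
  fix A :: "nat set" assume A: "A \<subseteq> {1..n}" "A \<noteq> {}"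
  have Ss: "distinct Ss" "\<Union> (set Ss) = {1..n}" "disjoint (set Ss)"
    using assms by (auto simp: set_compositions_def partition_on_def)
  have index: "i = j" if "i < length Ss" "j < length Ss" "x \<in> Ss ! i" "x \<in> Ss ! j" for i j x
    using that Ss by (metis disjointD disjoint_iff nth_eq_iff_index_eq nth_mem)
  have "(LEAST i. i < length Ss \<and> x \<in> Ss ! i) = i" if "i < length Ss" "x \<in> Ss ! i" for i x
    by (rule Least_equality) (use that index in blast)+
  then show "first_part A Ss = minimizers (\<lambda>x. LEAST i. i < length Ss \<and> x \<in> Ss ! i) A"
    using A Ss(2) by (intro first_part_eq_minimizers) simp_all
qed

section \<open>Comparison of equivalent set compositions\<close>

text \<open>
  Testing pairs shows which elements are tied; testing triples shows which elements lie above
  a given tied pair. Above tied elements the two rankings therefore agree.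
\<close>

lemma minimizers_eq_if_same_singletons:
  fixes r :: "'a \<Rightarrow> 'b::linorder" and s :: "'a \<Rightarrow> 'c::linorder"
  assumes same: "\<And>A. A \<noteq> {} \<Longrightarrow> A \<subseteq> U \<Longrightarrow>
      card (minimizers r A) = 1 \<longleftrightarrow> card (minimizers s A) = 1"
    and A: "finite A" "A \<noteq> {}" "A \<subseteq> U" "card (minimizers r A) \<noteq> 1"
  shows "minimizers s A = minimizers r A"
proof -
  have pair: "card (minimizers t {x, y}) = 1 \<longleftrightarrow> t x \<noteq> t y" if "x \<noteq> y"
    for t :: "'a \<Rightarrow> 'd::linorder" and x y
  proof -
    have "minimizers t {x, y} = (if t x = t y then {x, y} else if t x < t y then {x} else {y})"
      by (auto simp: minimizers_def)
    then show ?thesis using that by auto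
  qed
  have triple: "card (minimizers t {x, y, z}) = 1 \<longleftrightarrow> t z < t x" if "x \<noteq> y" "t x = t y"
    for t :: "'a \<Rightarrow> 'd::linorder" and x y z
  proof -
    have "minimizers t {x, y, z} =
        (if t z < t x then {z} else if t z = t x then {x, y, z} else {x, y})"
      using that(2) by (auto simp: minimizers_def)
    \<comment> \<open>\<open>z\<close> may coincide with \<open>x\<close> or \<open>y\<close>, but
      two distinct elements remain.\<close>
    moreover have "card {x, y, z} \<noteq> 1"
      using that(1) by (auto simp: card_1_singleton_iff)
    ultimately show ?thesis using that(1) by auto
  qed
  have eq: "r x = r y \<longleftrightarrow> s x = s y" if "x \<in> U" "y \<in> U" for x y
    using same[of "{x, y}"] pair[of x y r] pair[of x y s] that by (cases "x = y") auto
  have le: "r x \<le> r z \<longleftrightarrow> s x \<le> s z"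
    if "x \<noteq> y" "r x = r y" "x \<in> U" "y \<in> U" "z \<in> U" for x y z
    using same[of "{x, y, z}"] triple[of x y r z] triple[of x y s z] eq[of x y] that
    by (auto simp: not_less[symmetric])
  obtain x where x: "x \<in> minimizers r A"
    using minimizers_nonempty[OF A(1,2)] by blast
  \<comment> \<open>A non-empty minimal face that is not a singleton supplies a tied pair, against
    which triples compare every element of \<open>A\<close>.\<close>
  then have "minimizers r A \<noteq> {x}"
    using A(4) by auto
  then obtain y where y: "y \<in> minimizers r A" "y \<noteq> x"
    using x by blast
  have xy: "x \<noteq> y" "r x = r y" "x \<in> U" "y \<in> U" "x \<in> A"
    using x y A(3) by (auto simp: minimizers_def intro: order_antisym)
  have xs: "s x \<le> s z" if "z \<in> A" for z
    using le[OF xy(1-4), of z] x that A(3) by (auto simp: minimizers_def)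
  have "w \<in> minimizers s A \<longleftrightarrow> w \<in> minimizers r A" for w
  proof -
    have "w \<in> minimizers s A \<longleftrightarrow> w \<in> A \<and> s x = s w"
      using xs xy(5) by (auto simp: minimizers_def intro: order_antisym)
    also have "\<dots> \<longleftrightarrow> w \<in> A \<and> r x = r w"
      using eq[of x w] xy(3) A(3) by blast
    also have "\<dots> \<longleftrightarrow> w \<in> minimizers r A"
      using x by (auto simp: minimizers_def intro: order_antisym)
    finally show ?thesis .
  qed
  then show ?thesis by blast
qed

text \<open>For compositions of [n] this set determines the equivalence class, and inclusion of
  these sets is the order in which the system to be inverted is triangular.\<close>

definition nonsingular :: "nat \<Rightarrow> nat set list \<Rightarrow> nat set set" where
  "nonsingular n Ss = {A. A \<noteq> {} \<and> A \<subseteq> {1..n} \<and> card (first_part A Ss) \<noteq> 1}"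

lemma finite_nonsingular: "finite (nonsingular n Ss)"
  by (rule finite_subset[of _ "Pow {1..n}"]) (auto simp: nonsingular_def)

lemma sc_rel_iff_nonsingular:
  "(Ss, Ts) \<in> sc_rel n \<longleftrightarrow>
     Ss \<in> set_compositions n \<and> Ts \<in> set_compositions n \<and> nonsingular n Ss = nonsingular n Ts"
proof -
  have "nonsingular n Ss = nonsingular n Ts \<longleftrightarrow> (\<forall>A. A \<noteq> {} \<and> A \<subseteq> {1..n} \<longrightarrow>
      (card (first_part A Ss) = 1 \<longleftrightarrow> card (first_part A Ts) = 1))"
    unfolding nonsingular_def set_eq_iff[of "Collect _"] mem_Collect_eq by blast
  then show ?thesis
    unfolding sc_rel_def by simp
qed

text \<open>The relation records only which first parts are singletons; passing to rankings shows
  that it also fixes the other first parts. This makes defects constant on classes.\<close>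

lemma sc_rel_first_part_eq:
  assumes rel: "(Ss, Ts) \<in> sc_rel n"
    and A: "A \<noteq> {}" "A \<subseteq> {1..n}" "card (first_part A Ss) \<noteq> 1"
  shows "first_part A Ts = first_part A Ss"
proof -
  have Ss: "Ss \<in> set_compositions n" and Ts: "Ts \<in> set_compositions n"
    using rel by (auto simp: sc_rel_def)
  obtain r :: "nat \<Rightarrow> nat" where r: "\<And>A. A \<subseteq> {1..n} \<Longrightarrow> A \<noteq> {} \<Longrightarrow> first_part A Ss = minimizers r A"
    using set_composition_ranking[OF Ss] by blast
  obtain s :: "nat \<Rightarrow> nat" where s: "\<And>A. A \<subseteq> {1..n} \<Longrightarrow> A \<noteq> {} \<Longrightarrow> first_part A Ts = minimizers s A"
    using set_composition_ranking[OF Ts] by blast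
  have "minimizers s A = minimizers r A"
  proof (rule minimizers_eq_if_same_singletons[where U = "{1..n}"])
    show "card (minimizers r A) = 1 \<longleftrightarrow> card (minimizers s A) = 1" if "A \<noteq> {}" "A \<subseteq> {1..n}" for A
      using rel that by (auto simp: sc_rel_def simp flip: r s)
    show "finite A"
      using A(2) by (rule finite_subset) simp
  qed (use A r in auto)
  then show ?thesis using A r s by simp
qed

section \<open>Expansion of generic series\<close>

text \<open>Coefficients are cardinalities, and infinite sets have cardinality 0, so additivity of
  monomial sums rests on finite fibres. A word determines its extensional function, so each fibre
  has at most one element.\<close>

lemma finite_word_fibre:
  assumes "F \<subseteq> pos_funs n"
  shows "finite {f \<in> F. map f [1..<Suc n] = w}"
proof -
  have "inj_on (\<lambda>f. map f [1..<Suc n]) (pos_funs n)"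
  proof (rule inj_onI)
    fix f g assume "f \<in> pos_funs n" "g \<in> pos_funs n" "map f [1..<Suc n] = map g [1..<Suc n]"
    then show "f = g"
      unfolding pos_funs_def by (intro PiE_ext) auto
  qed
  then have "finite ((\<lambda>f. map f [1..<Suc n]) -` {w} \<inter> pos_funs n)"
    by (intro finite_vimage_IntI) simp_all
  then show ?thesis
    by (rule rev_finite_subset) (use assms in auto)
qed

lemma monomial_sum_Un:
  assumes "F \<subseteq> pos_funs n" "G \<subseteq> pos_funs n" "F \<inter> G = {}"
  shows "monomial_sum n (F \<union> G) = monomial_sum n F + monomial_sum n G"
proof
  fix w
  have "{f \<in> F \<union> G. map f [1..<Suc n] = w} =
      {f \<in> F. map f [1..<Suc n] = w} \<union> {f \<in> G. map f [1..<Suc n] = w}"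
    by blast
  then have "card {f \<in> F \<union> G. map f [1..<Suc n] = w} =
      card {f \<in> F. map f [1..<Suc n] = w} + card {f \<in> G. map f [1..<Suc n] = w}"
    using assms(3)
    by (simp only:) (intro card_Un_disjoint finite_word_fibre assms(1,2), blast)
  then show "monomial_sum n (F \<union> G) w = (monomial_sum n F + monomial_sum n G) w"
    unfolding monomial_sum_def plus_fun_def by (simp only: of_nat_add)
qed

lemma monomial_sum_eq_sum_M_series:
  assumes "finite T"
  shows "monomial_sum n {f \<in> pos_funs n. composition_of n f \<in> T} =
    (\<Sum>Ts\<in>T. M_series n Ts :: 'k::field nc_series)"
  using assms
proof (induction T rule: finite_induct)
  case empty
  then show ?case by (simp add: monomial_sum_def fun_eq_iff)
next
  case (insert t T)
  have "{f \<in> pos_funs n. composition_of n f \<in> insert t T} =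
      {f \<in> pos_funs n. composition_of n f = t} \<union> {f \<in> pos_funs n. composition_of n f \<in> T}"
    by auto
  then have "monomial_sum n {f \<in> pos_funs n. composition_of n f \<in> insert t T} =
      (M_series n t + monomial_sum n {f \<in> pos_funs n. composition_of n f \<in> T} :: 'k nc_series)"
    unfolding M_series_def by (simp only:) (rule monomial_sum_Un; use insert.hyps in auto)
  then show ?case
    by (simp only: sum.insert[OF insert.hyps] insert.IH)
qed

text \<open>A set of compositions saturated under the equivalence is the disjoint union of the
  classes it contains.\<close>

lemma monomial_sum_eq_sum_N_series:
  assumes T: "T \<subseteq> set_compositions n" "\<And>Ss Ts. Ss \<in> T \<Longrightarrow> (Ss, Ts) \<in> sc_rel n \<Longrightarrow> Ts \<in> T"
  shows "monomial_sum n {f \<in> pos_funs n. composition_of n f \<in> T} =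
    (\<Sum>C | C \<in> set_compositions n // sc_rel n \<and> C \<subseteq> T. N_series n C :: 'k::field nc_series)"
proof -
  let ?D = "{C \<in> set_compositions n // sc_rel n. C \<subseteq> T}"
  have "finite T"
    using T(1) finite_set_compositions by (rule finite_subset)
  have "T \<subseteq> \<Union> ?D"
  proof
    fix Ss assume Ss: "Ss \<in> T"
    then have "Ss \<in> sc_rel n `` {Ss}" "sc_rel n `` {Ss} \<in> ?D"
      using T equiv_class_self[OF equiv_sc_rel] by (auto intro: quotientI)
    then show "Ss \<in> \<Union> ?D" by blast
  qed
  then have "\<Union> ?D = T" by blast
  then have "(\<Sum>Ts\<in>T. M_series n Ts :: 'k nc_series) = (\<Sum>Ts\<in>\<Union> ?D. M_series n Ts)"
    by simp
  also have "\<dots> = (\<Sum>C\<in>?D. N_series n C)"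
    using \<open>finite T\<close> quotient_disj[OF equiv_sc_rel]
    by (subst sum.Union_disjoint) (auto simp: N_series_def intro: finite_subset)
  finally show ?thesis
    by (simp add: monomial_sum_eq_sum_M_series \<open>finite T\<close>)
qed

text \<open>Singleton faces contribute nothing to a defect, so they may differ between
  \<open>F\<close> and \<open>G\<close>.\<close>

lemma defect_cong:
  assumes "\<And>J. J \<noteq> {} \<Longrightarrow> J \<subseteq> {1..n} \<Longrightarrow> F J = G J \<or> card (F J) = 1 \<and> card (G J) = 1"
  shows "defect n a F i = defect n a G i"
  unfolding defect_def
proof (rule sum.cong)
  fix J assume "J \<in> {J. J \<noteq> {} \<and> J \<subseteq> {1..n}}"
  then have "F J = G J \<or> card (F J) = 1 \<and> card (G J) = 1"
    using assms by blast
  then show "(if i \<in> F J \<and> card (F J) \<noteq> 1 then a J else 0) =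
      (if i \<in> G J \<and> card (G J) \<noteq> 1 then a J else 0)"
    by (elim disjE) simp_all
qed simp

text \<open>A function is generic exactly when its composition lies in \<open>T\<close>, and
  \<open>T\<close> is saturated. The explicit \<open>T\<close> serves both inclusions: it places the
  series in the span and identifies the classes occurring for the witness.\<close>

lemma generic_series_eq_sum_N_series:
  assumes "q \<subseteq> Rn n"
    and "is_minkowski_diff
       (\<Sum>J | J \<noteq> {} \<and> J \<subseteq> {1..n} \<and> a J > 0. (\<lambda>x. a J *\<^sub>R x) ` std_simplex J)
       (\<Sum>J | J \<noteq> {} \<and> J \<subseteq> {1..n} \<and> a J < 0. (\<lambda>x. \<bar>a J\<bar> *\<^sub>R x) ` std_simplex J)
       q"
  defines "T \<equiv> {Ss \<in> set_compositions n. \<forall>i\<in>{1..n}. defect n a (\<lambda>J. first_part J Ss) i = 0}"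
  shows "generic_series (n, q) =
    (\<Sum>C | C \<in> set_compositions n // sc_rel n \<and> C \<subseteq> T. N_series n C)"
proof -
  have gen: "generic n q f \<longleftrightarrow> composition_of n f \<in> T" for f
  proof -
    have "defect n a (minimizers f) i = defect n a (\<lambda>J. first_part J (composition_of n f)) i" for i
      by (rule defect_cong) (simp add: first_part_composition_of)
    then show ?thesis
      using generic_iff_defect[OF assms(1,2)] composition_of_in_set_compositions
      by (simp add: T_def)
  qed
  have sat: "Ts \<in> T" if "Ss \<in> T" "(Ss, Ts) \<in> sc_rel n" for Ss Ts
  proof -
    have "defect n a (\<lambda>J. first_part J Ts) i = defect n a (\<lambda>J. first_part J Ss) i" for i
    proof (rule defect_cong)
      fix J :: "nat set" assume J: "J \<noteq> {}" "J \<subseteq> {1..n}"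
      show "first_part J Ts = first_part J Ss \<or>
          card (first_part J Ts) = 1 \<and> card (first_part J Ss) = 1"
      proof (cases "card (first_part J Ss) = 1")
        case True
        then show ?thesis using that(2) J unfolding sc_rel_def by blast
      next
        case False
        then show ?thesis using sc_rel_first_part_eq[OF that(2) J] by blast
      qed
    qed
    moreover have "Ts \<in> set_compositions n"
      using that(2) unfolding sc_rel_def by blast
    ultimately show ?thesis
      using that(1) by (simp add: T_def)
  qed
  have "T \<subseteq> set_compositions n"
    unfolding T_def by blast
  then show ?thesis
    unfolding generic_series_def prod.case gen
    by (rule monomial_sum_eq_sum_N_series) (rule sat)
qed

section \<open>The image\<close>

lemma set_plus_subset_Rn:
  assumes "A \<subseteq> Rn n" "B \<subseteq> Rn n"
  shows "A + B \<subseteq> Rn n"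
proof
  fix z assume "z \<in> A + B"
  then obtain x y where "z = x + y" "x \<in> Rn n" "y \<in> Rn n"
    using assms by (meson set_plus_elim subsetD)
  then show "z \<in> Rn n"
    using Poly_Mapping.keys_add[of x y] unfolding Rn_def by blast
qed

lemma polytope_set_plus: "polytope A \<Longrightarrow> polytope B \<Longrightarrow> polytope (A + B)"
  unfolding polytope_def by (metis convex_hull_set_plus finite_set_plus)

text \<open>Without negative coefficients the subtracted sum is the empty sum \<open>{0}\<close>, so
  only the support and polytopality of the positive sum need proof.\<close>

lemma nonneg_minkowski_sum:
  fixes n :: nat and a :: "nat set \<Rightarrow> real"
  assumes a: "\<And>J. a J \<ge> 0"
  defines "q \<equiv> \<Sum>J | J \<noteq> {} \<and> J \<subseteq> {1..n} \<and> a J > 0. (\<lambda>x. a J *\<^sub>R x) ` std_simplex J"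
  shows "q \<subseteq> Rn n"
    and "is_minkowski_diff q
       (\<Sum>J | J \<noteq> {} \<and> J \<subseteq> {1..n} \<and> a J < 0. (\<lambda>x. \<bar>a J\<bar> *\<^sub>R x) ` std_simplex J) q"
proof -
  let ?P = "\<lambda>J. (\<lambda>x. a J *\<^sub>R x) ` std_simplex J"
  have "(\<Sum>J\<in>I. ?P J) \<subseteq> Rn n \<and> polytope (\<Sum>J\<in>I. ?P J)" if "\<And>J. J \<in> I \<Longrightarrow> J \<subseteq> {1..n}" for I
    using that
  proof (induction I rule: infinite_finite_induct)
    case (insert J I)
    have J: "J \<subseteq> {1..n}" "finite J"
      using insert.prems by (auto intro: finite_subset)
    have "?P J \<subseteq> Rn n"
      using J by (force simp: Rn_def std_simplex_eq in_keys_iff lookup_scaleR)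
    moreover have "polytope (?P J)"
      using J by (auto simp: std_simplex_def intro!: polytope_linear_image polytope_convex_hull)
    moreover have "(\<Sum>J\<in>I. ?P J) \<subseteq> Rn n \<and> polytope (\<Sum>J\<in>I. ?P J)"
      by (rule insert.IH) (rule insert.prems, blast)
    ultimately show ?case
      unfolding sum.insert[OF insert.hyps]
      by (intro conjI set_plus_subset_Rn polytope_set_plus) simp_all
  qed (auto simp: Rn_def polytope_def intro!: exI[of _ "{0}"])
  from this[of "{J. J \<noteq> {} \<and> J \<subseteq> {1..n} \<and> a J > 0}"]
  have "q \<subseteq> Rn n" "polytope q"
    unfolding q_def by blast+
  moreover have neg: "{J. J \<noteq> {} \<and> J \<subseteq> {1..n} \<and> a J < 0} = {}"
    using a by (auto simp: not_less)
  ultimately show "q \<subseteq> Rn n" and "is_minkowski_diff q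
       (\<Sum>J | J \<noteq> {} \<and> J \<subseteq> {1..n} \<and> a J < 0. (\<lambda>x. \<bar>a J\<bar> *\<^sub>R x) ` std_simplex J) q"
    unfolding is_minkowski_diff_def neg by simp_all
qed

section \<open>Inversion of the triangular system\<close>

text \<open>The witness is the sum of the simplices of all \<open>J\<close> whose first part in \<open>Ss\<close> is a singleton.\<close>

lemma ex_generic_series_nonsingular_subset:
  assumes "Ss \<in> set_compositions n"
  obtains q where "gen_permutahedron n q"
    and "generic_series (n, q) = (\<Sum>C | C \<in> set_compositions n // sc_rel n \<and>
      C \<subseteq> {Ts \<in> set_compositions n. nonsingular n Ts \<subseteq> nonsingular n Ss}. N_series n C :: 'k::field nc_series)"
proof -
  define a where "a J = (if card (first_part J Ss) = 1 then 1 else 0 :: real)" for J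
  define q where "q = (\<Sum>J | J \<noteq> {} \<and> J \<subseteq> {1..n} \<and> a J > 0. (\<lambda>x. a J *\<^sub>R x) ` std_simplex J)"
  have nonneg: "a J \<ge> 0" for J
    by (simp add: a_def)
  note q = nonneg_minkowski_sum[of a n, OF nonneg, folded q_def]
  have fin: "finite {J. J \<noteq> {} \<and> J \<subseteq> {1..n}}"
    by (rule finite_subset[of _ "Pow {1..n}"]) auto
  have "(\<forall>i\<in>{1..n}. defect n a (\<lambda>J. first_part J Ts) i = 0) \<longleftrightarrow>
      nonsingular n Ts \<subseteq> nonsingular n Ss" (is "?D \<longleftrightarrow> _")
    if Ts: "Ts \<in> set_compositions n" for Ts
  proof -
    obtain r :: "nat \<Rightarrow> nat" where r: "\<And>A. A \<subseteq> {1..n} \<Longrightarrow> A \<noteq> {} \<Longrightarrow> first_part A Ts = minimizers r A"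
      using set_composition_ranking[OF Ts] by blast
    \<comment> \<open>The first part of every non-empty \<open>J\<close> contains some
      \<open>i\<close> in [n], so testing all \<open>i\<close> tests all \<open>J\<close>.\<close>
    have ex: "\<exists>i\<in>{1..n}. i \<in> first_part J Ts" if "J \<noteq> {}" "J \<subseteq> {1..n}" for J
      using that minimizers_nonempty[of J r] minimizers_subset[of r J] finite_subset[OF that(2)]
      by (auto simp: r)
    \<comment> \<open>All coefficients are non-negative, so a defect vanishes only if each of its
      terms does.\<close>
    have "?D \<longleftrightarrow> (\<forall>i\<in>{1..n}. \<forall>J\<in>{J. J \<noteq> {} \<and> J \<subseteq> {1..n}}.
        (if i \<in> first_part J Ts \<and> card (first_part J Ts) \<noteq> 1 then a J else 0) = 0)"
      unfolding defect_def
      by (intro ball_cong refl sum_nonneg_eq_0_iff fin) (simp add: nonneg)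
    also have "\<dots> \<longleftrightarrow> (\<forall>J. J \<noteq> {} \<and> J \<subseteq> {1..n} \<and> card (first_part J Ts) \<noteq> 1 \<longrightarrow> a J = 0)"
      (is "?lhs \<longleftrightarrow> ?rhs")
    proof
      assume lhs: ?lhs
      show ?rhs
      proof (intro allI impI)
        fix J assume J: "J \<noteq> {} \<and> J \<subseteq> {1..n} \<and> card (first_part J Ts) \<noteq> 1"
        then obtain i where i: "i \<in> {1..n}" "i \<in> first_part J Ts"
          using ex[of J] by blast
        then have "(if i \<in> first_part J Ts \<and> card (first_part J Ts) \<noteq> 1 then a J else 0) = 0"
          using lhs J by blast
        then show "a J = 0"
          using i(2) J by simp
      qed
    next
      assume ?rhs
      then show ?lhs by simp
    qed
    also have "\<dots> \<longleftrightarrow> nonsingular n Ts \<subseteq> nonsingular n Ss"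
    proof -
      have "a J = 0 \<longleftrightarrow> card (first_part J Ss) \<noteq> 1" for J
        by (simp add: a_def)
      then show ?thesis
        unfolding nonsingular_def by blast
    qed
    finally show ?thesis .
  qed
  then have "{Ts \<in> set_compositions n. \<forall>i\<in>{1..n}. defect n a (\<lambda>J. first_part J Ts) i = 0} =
      {Ts \<in> set_compositions n. nonsingular n Ts \<subseteq> nonsingular n Ss}"
    by blast
  then have "generic_series (n, q) = (\<Sum>C | C \<in> set_compositions n // sc_rel n \<and>
      C \<subseteq> {Ts \<in> set_compositions n. nonsingular n Ts \<subseteq> nonsingular n Ss}. N_series n C :: 'k::field nc_series)"
    using generic_series_eq_sum_N_series[OF q[unfolded q_def]] unfolding q_def by simp
  moreover have "gen_permutahedron n q"
    using q unfolding gen_permutahedron_def q_def by blast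
  ultimately show thesis by (rule that[rotated])
qed

text \<open>The witness series for \<open>Ss\<close> contains \<open>N_series\<close> of the class
  of \<open>Ss\<close> with coefficient 1. All other classes in it have strictly fewer nonsingular
  sets, so they are subtracted by induction.\<close>

lemma N_series_in_subspace:
  fixes V :: "'k::field nc_series set"
  assumes V: "nc.subspace V" "\<And>n q. gen_permutahedron n q \<Longrightarrow> generic_series (n, q) \<in> V"
    and "Ss \<in> set_compositions n"
  shows "N_series n (sc_rel n `` {Ss}) \<in> V"
  using assms(3)
proof (induction "card (nonsingular n Ss)" arbitrary: Ss rule: less_induct)
  case less
  let ?D = "{C. C \<in> set_compositions n // sc_rel n \<and>
      C \<subseteq> {Ts \<in> set_compositions n. nonsingular n Ts \<subseteq> nonsingular n Ss}}"
  let ?C = "sc_rel n `` {Ss}"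
  obtain q where q: "gen_permutahedron n q" "generic_series (n, q) = (\<Sum>C\<in>?D. N_series n C :: 'k nc_series)"
    by (rule ex_generic_series_nonsingular_subset[OF less.prems, where 'k = 'k])
  have fin: "finite ?D"
    by (rule finite_subset[of _ "Pow (set_compositions n)"])
      (auto simp: finite_set_compositions)
  have "?C \<in> ?D"
    using less.prems by (auto simp: sc_rel_iff_nonsingular intro: quotientI)
  then have "N_series n ?C = (generic_series (n, q) - (\<Sum>C\<in>?D - {?C}. N_series n C) :: 'k nc_series)"
    using fin by (simp add: q(2) sum.remove)
  also have "\<dots> \<in> V"
  proof (intro nc.subspace_diff nc.subspace_sum V q(1))
    fix C assume C: "C \<in> ?D - {?C}"
    then have "C \<in> set_compositions n // sc_rel n"
      by blast
    then obtain Ts where Ts: "C = sc_rel n `` {Ts}" "Ts \<in> set_compositions n"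
      by (rule quotientE)
    then have "Ts \<in> C"
      using equiv_class_self[OF equiv_sc_rel] by blast
    then have "nonsingular n Ts \<subseteq> nonsingular n Ss"
      using C by blast
    \<comment> \<open>Equality would put \<open>Ts\<close> in the class of \<open>Ss\<close>, which
      has been removed from the sum.\<close>
    moreover have "nonsingular n Ts \<noteq> nonsingular n Ss"
    proof
      assume "nonsingular n Ts = nonsingular n Ss"
      then have "(Ts, Ss) \<in> sc_rel n"
        using Ts less.prems by (simp add: sc_rel_iff_nonsingular)
      then show False
        using C Ts equiv_class_eq[OF equiv_sc_rel] by blast
    qed
    ultimately have "card (nonsingular n Ts) < card (nonsingular n Ss)"
      using finite_nonsingular by (intro psubset_card_mono) auto
    then show "N_series n C \<in> V"
      using less.hyps Ts by simp
  qed
  finally show ?case .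
qed

section \<open>Linearity of the image and the two inclusions\<close>

lemma subspace_Upsilon_GP_image: "nc.subspace (Upsilon_GP ` GP :: 'k::field nc_series set)"
proof (rule nc.subspaceI)
  show "0 \<in> (Upsilon_GP ` GP :: 'k nc_series set)"
    by (rule image_eqI[of _ _ 0]) (simp_all add: Upsilon_GP_def GP_def)
  show "u + v \<in> Upsilon_GP ` GP" if uv: "u \<in> Upsilon_GP ` GP" "v \<in> Upsilon_GP ` GP"
    for u v :: "'k nc_series"
  proof -
    obtain x y where xy: "u = Upsilon_GP x" "v = Upsilon_GP y" "x \<in> GP" "y \<in> GP"
      using uv by blast
    then have "x + y \<in> GP"
      using Poly_Mapping.keys_add[of x y] by (auto simp: GP_def)
    then show ?thesis
      using xy by (auto simp flip: Upsilon_GP_add)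
  qed
  show "nc_scale c u \<in> Upsilon_GP ` GP" if u: "u \<in> Upsilon_GP ` GP" for c and u :: "'k nc_series"
  proof -
    obtain x where x: "u = Upsilon_GP x" "x \<in> GP"
      using u by blast
    have "Poly_Mapping.keys (Poly_Mapping.map ((*) c) x) \<subseteq> Poly_Mapping.keys x"
      by (auto simp: in_keys_iff Poly_Mapping.map.rep_eq when_def)
    then have "Poly_Mapping.map ((*) c) x \<in> GP"
      using x(2) by (auto simp: GP_def)
    then show ?thesis
      using x by (auto simp flip: Upsilon_GP_scale)
  qed
qed

lemma generic_series_in_image:
  assumes "gen_permutahedron n q"
  shows "generic_series (n, q) \<in> (Upsilon_GP ` GP :: 'k::field nc_series set)"
proof (rule image_eqI)
  show "(Poly_Mapping.single (n, q) 1 :: _ \<Rightarrow>\<^sub>0 'k) \<in> GP"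
    using assms by (simp add: GP_def)
qed (simp add: Upsilon_GP_single)

lemma SC_subset_WQSym: "SC \<subseteq> WQSym"
  unfolding SC_def
proof (rule nc.span_minimal)
  show "nc.subspace WQSym"
    unfolding WQSym_def by (rule nc.subspace_span)
  show "{N_series n C | n C. C \<in> set_compositions n // sc_rel n} \<subseteq> WQSym"
  proof clarify
    fix n C assume "C \<in> set_compositions n // sc_rel n"
    then have "C \<subseteq> set_compositions n"
      using in_quotient_imp_subset[OF equiv_sc_rel] by blast
    then show "N_series n C \<in> WQSym"
      unfolding N_series_def WQSym_def by (intro nc.span_sum nc.span_base) auto
  qed
qed

theorem theorem35:
  shows "(Upsilon_GP :: _ \<Rightarrow> 'k::field_char_0 nc_series) \<in> GP \<rightarrow> WQSym \<and>
         Upsilon_GP ` GP = (SC :: 'k nc_series set)"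
proof -
  have "generic_series (n, q) \<in> (SC :: 'k nc_series set)" if q: "gen_permutahedron n q" for n q
  proof -
    obtain a where a: "q \<subseteq> Rn n" "is_minkowski_diff
       (\<Sum>J | J \<noteq> {} \<and> J \<subseteq> {1..n} \<and> a J > 0. (\<lambda>x. a J *\<^sub>R x) ` std_simplex J)
       (\<Sum>J | J \<noteq> {} \<and> J \<subseteq> {1..n} \<and> a J < 0. (\<lambda>x. \<bar>a J\<bar> *\<^sub>R x) ` std_simplex J) q"
      using q unfolding gen_permutahedron_def by blast
    show ?thesis
      unfolding generic_series_eq_sum_N_series[OF a] SC_def
      by (intro nc.span_sum nc.span_base) blast
  qed
  then have "Upsilon_GP x \<in> SC" if "x \<in> GP" for x :: "_ \<Rightarrow>\<^sub>0 'k"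
    using that unfolding Upsilon_GP_def SC_def
    by (intro nc.span_sum nc.span_scale) (auto simp: GP_def)
  then have "Upsilon_GP ` GP \<subseteq> (SC :: 'k nc_series set)"
    by blast
  moreover have "(SC :: 'k nc_series set) \<subseteq> Upsilon_GP ` GP"
    unfolding SC_def
  \<comment> \<open>The image is a subspace containing every generic series, so the triangular
    inversion reaches each generator of \<open>SC\<close>.\<close>
  proof (rule nc.span_minimal[OF _ subspace_Upsilon_GP_image], clarify)
    fix n C assume "C \<in> set_compositions n // sc_rel n"
    then show "N_series n C \<in> (Upsilon_GP ` GP :: 'k nc_series set)"
      using N_series_in_subspace[OF subspace_Upsilon_GP_image generic_series_in_image]
      by (auto elim!: quotientE)
  qed
  ultimately show ?thesis
    using SC_subset_WQSym by blast
qed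

end
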